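(* Let $G$ be a connected graph of size $m\geq 1$ with maximum degree $\Delta$ and minimum degree $\delta$, and let $\mathcal{M}=M_{DS}(G)$. Then $$\sqrt{\frac12\Big(\operatorname{tr}(\mathcal{M}^2)+m(m-1)\Big(\frac{\delta}{\Delta}\Big)^2\Big)}\leq DSO(G)\leq \sqrt{\frac12\Big(\operatorname{tr}(\mathcal{M}^2)+m(m-1)\Big(\frac{\Delta}{\delta}\Big)^2\Big)}.$$ Equality (in either inequality) holds if and only if $G$ is a regular graph.
   Context: All graphs are finite, simple and undirected; the size is the number of edges. For a graph $G$ with vertices $v_1,\dots,v_n$ and degrees $d_i=d_{v_i}$, the diminished Sombor matrix $M_{DS}(G)=(\mu_{ij})$ is the $n\times n$ real symmetric matrix with $\mu_{ij}=\frac{\sqrt{d_i^2+d_j^2}}{d_i+d_j}$ if $v_iv_j\in E(G)$, and $\mu_{ij}=0$ otherwise. The diminished Sombor index is $DSO(G)=\sum_{uv\in E(G)}\frac{\sqrt{d_u^2+d_v^2}}{d_u+d_v}$. *)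

theory Defs
  imports "HOL-Analysis.Analysis"
begin

text \<open>
  A finite simple graph is given by a finite vertex type \<open>'v\<close> (every element of the type is a
  vertex) and a set \<open>E\<close> of two-element subsets of that type.  The vertex type also indexes the
  rows and columns of the matrix of the graph.
\<close>

definition simple_graph :: "'v::finite set set \<Rightarrow> bool" where
  "simple_graph E \<longleftrightarrow> (\<forall>e\<in>E. card e = 2)"

definition connected_graph :: "'v::finite set set \<Rightarrow> bool" where
  "connected_graph E \<longleftrightarrow> (\<forall>u v. (u, v) \<in> {(x, y). {x, y} \<in> E}\<^sup>*)"

definition degree :: "'v::finite set set \<Rightarrow> 'v \<Rightarrow> nat" where
  "degree E v = card {e \<in> E. v \<in> e}"

definition max_degree :: "'v::finite set set \<Rightarrow> nat" where
  "max_degree E = Max (range (degree E))"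

definition min_degree :: "'v::finite set set \<Rightarrow> nat" where
  "min_degree E = Min (range (degree E))"

definition regular_graph :: "'v::finite set set \<Rightarrow> bool" where
  "regular_graph E \<longleftrightarrow> (\<exists>k. \<forall>v. degree E v = k)"

definition M_DS :: "'v::finite set set \<Rightarrow> real ^ 'v ^ 'v" where
  "M_DS E = (\<chi> i j. if {i, j} \<in> E
     then sqrt ((real (degree E i))\<^sup>2 + (real (degree E j))\<^sup>2) / (real (degree E i) + real (degree E j))
     else 0)"

text \<open>
  Edges are unordered, so the summand for an edge \<open>e\<close> is written with sums over its two
  endpoints; \<open>DSO_summand\<close> gives the usual form in terms of the endpoints.
\<close>

definition DSO :: "'v::finite set set \<Rightarrow> real" where
  "DSO E = (\<Sum>e\<in>E. sqrt (\<Sum>u\<in>e. (real (degree E u))\<^sup>2) / (\<Sum>u\<in>e. real (degree E u)))"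

lemma DSO_summand:
  assumes "simple_graph E" and "{u, v} \<in> E"
  shows "sqrt (\<Sum>w\<in>{u, v}. (real (degree E w))\<^sup>2) / (\<Sum>w\<in>{u, v}. real (degree E w))
    = sqrt ((real (degree E u))\<^sup>2 + (real (degree E v))\<^sup>2) / (real (degree E u) + real (degree E v))"
proof -
  have "card {u, v} = 2"
    using assms by (auto simp: simple_graph_def)
  then have "u \<noteq> v"
    by auto
  then show ?thesis
    by simp
qed

end

theory Submission
  imports Defs
begin

text \<open>
  Let \<open>w\<^sub>e\<close> be the summand of the edge \<open>e\<close> in the index.  Then \<open>tr(M\<^sup>2) = 2 \<Sum> w\<^sub>e\<^sup>2\<close>, so after squaring
  both inequalities bound the off-diagonal part \<open>(\<Sum> w\<^sub>e)\<^sup>2 - \<Sum> w\<^sub>e\<^sup>2\<close>, a sum of \<open>m(m - 1)\<close> products.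
  For an edge with end degrees \<open>a\<close>, \<open>b\<close> one has \<open>w\<^sub>e\<^sup>2 \<ge> 1/2\<close>, and \<open>a\<^sup>2 + b\<^sup>2 \<le> \<Delta> (a + b)\<close> gives
  \<open>w\<^sub>e\<^sup>2 \<le> \<Delta> / (a + b) \<le> (\<Delta> / \<delta>) / 2\<close>.  Thus \<open>m(m - 1)/2\<close> and \<open>(\<Delta> / \<delta>) m(m - 1)/2\<close> are bounds
  for the off-diagonal part; for \<open>m \<ge> 2\<close> they are strictly better than the claimed ones unless
  \<open>\<delta> = \<Delta>\<close>, and for \<open>m = 1\<close> the graph is a single edge.
\<close>

definition DSO_weight :: "'v::finite set set \<Rightarrow> 'v set \<Rightarrow> real" where
  "DSO_weight E e = sqrt (\<Sum>u\<in>e. (real (degree E u))\<^sup>2) / (\<Sum>u\<in>e. real (degree E u))"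

lemma DSO_eq_sum_weight: "DSO E = (\<Sum>e\<in>E. DSO_weight E e)"
  by (simp add: DSO_def DSO_weight_def)

lemma M_DS_nth:
  assumes "simple_graph E"
  shows "M_DS E $ i $ j = (if {i, j} \<in> E then DSO_weight E {i, j} else 0)"
  using DSO_summand[OF assms, of i j] by (simp add: M_DS_def DSO_weight_def)

text \<open>Grouping the ordered pairs by the edge they span gives fibers of size two, since the
  ends of an edge are distinct.\<close>

lemma sum_over_adjacent_pairs:
  fixes h :: "'v::finite set \<Rightarrow> real"
  assumes "simple_graph E"
  shows "(\<Sum>i\<in>UNIV. \<Sum>j\<in>UNIV. if {i, j} \<in> E then h {i, j} else 0) = 2 * (\<Sum>e\<in>E. h e)"
proof -
  let ?P = "{p :: 'v \<times> 'v. {fst p, snd p} \<in> E}"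
  have fiber: "(\<Sum>p\<in>{p \<in> ?P. {fst p, snd p} = e}. h {fst p, snd p}) = 2 * h e" if "e \<in> E" for e
  proof -
    have "card e = 2"
      using assms that by (auto simp: simple_graph_def)
    then obtain a b where ab: "e = {a, b}" "a \<noteq> b"
      by (auto simp: card_2_iff)
    have "{p \<in> ?P. {fst p, snd p} = e} = {p. {fst p, snd p} = {a, b}}"
      using that unfolding ab by (intro Collect_cong) auto
    also have "\<dots> = {(a, b), (b, a)}"
      by (rule set_eqI) (simp add: doubleton_eq_iff prod_eq_iff)
    finally have "{p \<in> ?P. {fst p, snd p} = e} = {(a, b), (b, a)}" .
    then show ?thesis
      using ab by (simp add: insert_commute)
  qed
  have "(\<Sum>i\<in>UNIV. \<Sum>j\<in>UNIV. if {i, j} \<in> E then h {i, j} else 0)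
      = (\<Sum>p\<in>UNIV. if {fst p, snd p} \<in> E then h {fst p, snd p} else 0)"
    by (simp add: sum.cartesian_product case_prod_beta)
  also have "\<dots> = (\<Sum>p\<in>?P. h {fst p, snd p})"
    by (simp add: sum.If_cases)
  also have "\<dots> = (\<Sum>e\<in>E. \<Sum>p\<in>{p \<in> ?P. {fst p, snd p} = e}. h {fst p, snd p})"
    by (subst sum.group) auto
  also have "\<dots> = 2 * (\<Sum>e\<in>E. h e)"
    unfolding sum_distrib_left by (intro sum.cong refl fiber)
  finally show ?thesis .
qed

text \<open>The matrix is symmetric, so the trace of its square is the sum of its squared entries,
  in which every edge is counted twice.\<close>

lemma trace_M_DS_square:
  assumes "simple_graph E"
  shows "trace (M_DS E ** M_DS E) = 2 * (\<Sum>e\<in>E. (DSO_weight E e)\<^sup>2)"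
proof -
  have "trace (M_DS E ** M_DS E)
      = (\<Sum>i\<in>UNIV. \<Sum>j\<in>UNIV. if {i, j} \<in> E then (DSO_weight E {i, j})\<^sup>2 else 0)"
    by (auto simp: trace_def matrix_matrix_mult_def M_DS_nth[OF assms] insert_commute
        power2_eq_square intro!: sum.cong)
  then show ?thesis
    using sum_over_adjacent_pairs[OF assms, of "\<lambda>e. (DSO_weight E e)\<^sup>2"] by simp
qed

lemma off_diagonal_sum:
  fixes f :: "'a \<Rightarrow> real"
  assumes "finite A"
  shows "(\<Sum>x\<in>A. \<Sum>y\<in>A - {x}. f x * f y) = (\<Sum>x\<in>A. f x)\<^sup>2 - (\<Sum>x\<in>A. (f x)\<^sup>2)"
  using assms
  by (simp add: sum_diff1 power2_eq_square sum_product sum_subtractf)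

lemma card_off_diagonal_sum:
  fixes c :: real
  assumes "finite A"
  shows "(\<Sum>x\<in>A. \<Sum>y\<in>A - {x}. c) = real (card A) * (real (card A) - 1) * c"
  \<comment> \<open>For empty \<open>A\<close> the natural number \<open>card A - 1\<close> is
    truncated to 0 and differs from \<open>real (card A) - 1\<close>, but both sides still
    vanish.\<close>
  using assms by (cases "A = {}") (auto simp: Suc_le_eq card_gt_0_iff of_nat_diff)

lemma off_diagonal_lower:
  fixes f :: "'a \<Rightarrow> real"
  assumes "finite A" and "\<And>x. x \<in> A \<Longrightarrow> f x \<ge> 0" and "\<And>x. x \<in> A \<Longrightarrow> c \<le> (f x)\<^sup>2" and "c \<ge> 0"
  shows "real (card A) * (real (card A) - 1) * c \<le> (\<Sum>x\<in>A. f x)\<^sup>2 - (\<Sum>x\<in>A. (f x)\<^sup>2)"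
proof -
  \<comment> \<open>Each factor is at least \<open>sqrt c\<close>, so the bound on squares passes to
    mixed products.\<close>
  have "c \<le> f x * f y" if "x \<in> A" "y \<in> A" for x y
  proof -
    have "sqrt c \<le> f x" "sqrt c \<le> f y"
      using assms that by (auto intro: real_le_lsqrt)
    then have "sqrt c * sqrt c \<le> f x * f y"
      using assms that by (intro mult_mono) auto
    then show ?thesis
      using \<open>c \<ge> 0\<close> by simp
  qed
  then show ?thesis
    unfolding off_diagonal_sum[OF assms(1), symmetric] card_off_diagonal_sum[OF assms(1), symmetric]
    by (intro sum_mono) auto
qed

lemma off_diagonal_upper:
  fixes f :: "'a \<Rightarrow> real"
  assumes "finite A" and "\<And>x. x \<in> A \<Longrightarrow> f x \<ge> 0" and "\<And>x. x \<in> A \<Longrightarrow> (f x)\<^sup>2 \<le> c"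
  shows "(\<Sum>x\<in>A. f x)\<^sup>2 - (\<Sum>x\<in>A. (f x)\<^sup>2) \<le> real (card A) * (real (card A) - 1) * c"
proof -
  \<comment> \<open>A mixed product is at most the mean of the two squares.\<close>
  have "f x * f y \<le> c" if "x \<in> A" "y \<in> A" for x y
  proof -
    have "2 * (f x * f y) \<le> (f x)\<^sup>2 + (f y)\<^sup>2"
      using sum_squares_bound[of "f x" "f y"] by simp
    then show ?thesis
      using assms(3)[OF that(1)] assms(3)[OF that(2)] by linarith
  qed
  then show ?thesis
    unfolding off_diagonal_sum[OF assms(1), symmetric] card_off_diagonal_sum[OF assms(1), symmetric]
    by (intro sum_mono) auto
qed

lemma min_degree_le: "min_degree E \<le> degree E v"
  by (simp add: min_degree_def)

lemma max_degree_ge: "degree E v \<le> max_degree E"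
  by (simp add: max_degree_def)

lemma regular_graph_iff: "regular_graph E \<longleftrightarrow> min_degree E = max_degree E"
proof
  assume "regular_graph E"
  then obtain k where "\<forall>v. degree E v = k"
    by (auto simp: regular_graph_def)
  then have "range (degree E) = {k}"
    by auto
  then show "min_degree E = max_degree E"
    by (simp add: min_degree_def max_degree_def)
next
  assume "min_degree E = max_degree E"
  then have "degree E v = max_degree E" for v
    using min_degree_le[of E v] max_degree_ge[of E v] by simp
  then show "regular_graph E"
    by (auto simp: regular_graph_def)
qed

text \<open>The ends of any edge supply a vertex other than \<open>v\<close>; a path from
  \<open>v\<close> to it must leave \<open>v\<close> along an edge.\<close>

lemma connected_graph_covers:
  fixes E :: "'v::finite set set"
  assumes "simple_graph E" and "connected_graph E" and "E \<noteq> {}"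
  obtains e where "e \<in> E" and "v \<in> e"
proof -
  obtain e where "e \<in> E"
    using assms(3) by blast
  then have "card e = 2"
    using assms(1) by (simp add: simple_graph_def)
  then obtain a b :: 'v where "a \<noteq> b"
    by (auto simp: card_2_iff)
  then have "a \<noteq> v \<or> b \<noteq> v"
    by auto
  then obtain w where "w \<noteq> v"
    by blast
  have "(v, w) \<in> {(x, y). {x, y} \<in> E}\<^sup>*"
    using assms(2) by (simp add: connected_graph_def)
  then obtain y where "{v, y} \<in> E"
    using \<open>w \<noteq> v\<close> by (cases rule: converse_rtranclE) auto
  then show ?thesis
    using that by blast
qed

text \<open>This makes the quotients by \<open>min_degree E\<close> genuine, rather than the default
  value 0 of division by zero.\<close>

lemma min_degree_pos:
  assumes "simple_graph E" and "connected_graph E" and "E \<noteq> {}"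
  shows "min_degree E > 0"
proof -
  have "degree E v > 0" for v
    using connected_graph_covers[OF assms, of v] by (auto simp: degree_def card_gt_0_iff)
  moreover have "min_degree E \<in> range (degree E)"
    unfolding min_degree_def by (intro Min_in) auto
  ultimately show ?thesis
    by auto
qed

text \<open>With one edge the off-diagonal part is empty and both bounds are attained, so regularity
  has to come from the graph itself: every vertex lies on the only edge.\<close>

lemma single_edge_regular:
  assumes "simple_graph E" and "connected_graph E" and "card E = 1"
  shows "regular_graph E"
proof -
  obtain e where E: "E = {e}"
    using assms(3) by (auto simp: card_1_singleton_iff)
  have "degree E v = 1" for v
  proof -
    have "{e' \<in> E. v \<in> e'} = {e}"
      using connected_graph_covers[OF assms(1,2), of v] E by auto
    then show ?thesis
      by (simp add: degree_def)
  qed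
  then show ?thesis
    by (auto simp: regular_graph_def)
qed

lemma DSO_weight_nonneg: "DSO_weight E e \<ge> 0"
  by (simp add: DSO_weight_def sum_nonneg)

lemma DSO_weight_square_bounds:
  assumes "simple_graph E" and "e \<in> E" and "min_degree E > 0"
  shows "1 / 2 \<le> (DSO_weight E e)\<^sup>2"
    and "(DSO_weight E e)\<^sup>2 \<le> real (max_degree E) / real (min_degree E) / 2"
proof -
  have "card e = 2"
    using assms by (auto simp: simple_graph_def)
  then obtain u v where uv: "e = {u, v}" "u \<noteq> v"
    by (auto simp: card_2_iff)
  define a b where "a = real (degree E u)" and "b = real (degree E v)"
  define D d where "D = real (max_degree E)" and "d = real (min_degree E)"
  have bounds: "0 < d" "d \<le> a" "d \<le> b" "a \<le> D" "b \<le> D"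
    using assms(3) by (auto simp: a_def b_def D_def d_def min_degree_le max_degree_ge)
  have w: "(DSO_weight E e)\<^sup>2 = (a\<^sup>2 + b\<^sup>2) / (a + b)\<^sup>2"
    using uv by (simp add: DSO_weight_def a_def b_def power_divide)
  have "(a + b)\<^sup>2 \<le> 2 * (a\<^sup>2 + b\<^sup>2)"
    using sum_squares_bound[of a b] by (simp add: power2_sum)
  then show "1 / 2 \<le> (DSO_weight E e)\<^sup>2"
    using bounds by (simp add: w field_simps)
  \<comment> \<open>Termwise, \<open>a * a \<le> D * a\<close> and
    \<open>b * b \<le> D * b\<close>.\<close>
  have "a\<^sup>2 + b\<^sup>2 \<le> D * (a + b)"
    using bounds by (simp add: power2_eq_square distrib_left add_mono mult_right_mono)
  then have "(a\<^sup>2 + b\<^sup>2) / (a + b)\<^sup>2 \<le> D * (a + b) / (a + b)\<^sup>2"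
    by (intro divide_right_mono) auto
  also have "\<dots> = D / (a + b)"
    using bounds by (simp add: power2_eq_square)
  also have "\<dots> \<le> D / (2 * d)"
    using bounds by (intro divide_left_mono) auto
  finally show "(DSO_weight E e)\<^sup>2 \<le> real (max_degree E) / real (min_degree E) / 2"
    by (simp add: w D_def d_def mult.commute)
qed

theorem theorem3p8:
  fixes E :: "'v::finite set set"
    and m \<Delta> \<delta> :: nat
    and M :: "real ^ 'v ^ 'v"
  assumes "simple_graph E"
    and "connected_graph E"
    and "m = card E"
    and "m \<ge> 1"
    and "\<Delta> = max_degree E"
    and "\<delta> = min_degree E"
    and "M = M_DS E"
  shows "sqrt (1/2 * (trace (M ** M) + real m * (real m - 1) * (real \<delta> / real \<Delta>)\<^sup>2)) \<le> DSO E
    \<and> DSO E \<le> sqrt (1/2 * (trace (M ** M) + real m * (real m - 1) * (real \<Delta> / real \<delta>)\<^sup>2))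
    \<and> (sqrt (1/2 * (trace (M ** M) + real m * (real m - 1) * (real \<delta> / real \<Delta>)\<^sup>2)) = DSO E
         \<longleftrightarrow> regular_graph E)
    \<and> (DSO E = sqrt (1/2 * (trace (M ** M) + real m * (real m - 1) * (real \<Delta> / real \<delta>)\<^sup>2))
         \<longleftrightarrow> regular_graph E)"
proof -
  \<comment> \<open>In these terms the index is \<open>sqrt (S + P)\<close> and the two bounds are
    \<open>sqrt (S + k * (1 / r)\<^sup>2)\<close> and \<open>sqrt (S + k * r\<^sup>2)\<close>, so
    only \<open>P\<close> has to be compared with multiples of \<open>k\<close>.\<close>
  define S where "S = (\<Sum>e\<in>E. (DSO_weight E e)\<^sup>2)"
  define r where "r = real \<Delta> / real \<delta>"
  define k where "k = real m * (real m - 1) / 2"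
  define P where "P = (DSO E)\<^sup>2 - S"
  have "E \<noteq> {}"
    using assms(3,4) by auto
  then have \<delta>_pos: "\<delta> > 0"
    using min_degree_pos[OF assms(1,2)] assms(6) by simp
  have "\<delta> \<le> \<Delta>"
    using le_trans[OF min_degree_le max_degree_ge] by (simp add: assms(5,6))
  then have r_ge: "r \<ge> 1"
    using \<delta>_pos by (simp add: r_def)
  have regular: "regular_graph E \<longleftrightarrow> r = 1"
    using \<delta>_pos by (auto simp: regular_graph_iff assms(5,6) r_def)
  have k_nonneg: "k \<ge> 0"
    using assms(4) by (simp add: k_def)
  \<comment> \<open>As \<open>m\<close> is positive, \<open>k\<close> vanishes only for
    \<open>m = 1\<close>. This is the case in which \<open>k\<close> cannot be cancelled in the
    equality arguments below.\<close>
  have k_zero: "r = 1" if "k = 0"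
  proof -
    have "card E = 1"
      using that assms(3,4) by (auto simp: k_def)
    then show ?thesis
      using single_edge_regular[OF assms(1,2)] regular by simp
  qed
  have P_lower: "k \<le> P"
    using off_diagonal_lower[of E "DSO_weight E" "1 / 2"]
      DSO_weight_square_bounds(1)[OF assms(1)] \<delta>_pos
    by (simp add: k_def P_def S_def DSO_weight_nonneg DSO_eq_sum_weight assms(3,6))
  have P_upper: "P \<le> k * r"
    using off_diagonal_upper[of E "DSO_weight E" "r / 2"]
      DSO_weight_square_bounds(2)[OF assms(1)] \<delta>_pos
    by (simp add: k_def P_def S_def r_def DSO_weight_nonneg DSO_eq_sum_weight assms(3,5,6))
  have DSO: "DSO E = sqrt (S + P)"
    by (simp add: P_def DSO_eq_sum_weight sum_nonneg DSO_weight_nonneg)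
  have inv: "(real \<delta> / real \<Delta>)\<^sup>2 = (1 / r)\<^sup>2"
    by (simp add: r_def)
  have radicand: "1/2 * (trace (M ** M) + real m * (real m - 1) * x) = S + k * x" for x
    by (simp add: assms(7) trace_M_DS_square[OF assms(1)] S_def k_def)
  have inv_sq_le: "(1 / r)\<^sup>2 \<le> 1"
    using r_ge by (simp add: power_le_one)
  have r_le_sq: "r \<le> r\<^sup>2"
    using r_ge by (simp add: power2_eq_square)
  have lower: "k * (1 / r)\<^sup>2 \<le> k" and upper: "k * r \<le> k * r\<^sup>2"
    using mult_left_mono[OF inv_sq_le k_nonneg] mult_left_mono[OF r_le_sq k_nonneg] by auto
  \<comment> \<open>Equality collapses the chain \<open>k * (1 / r)\<^sup>2 \<le> k \<le> P\<close>;
    conversely, for \<open>r = 1\<close> the bounds \<open>k \<le> P \<le> k * r\<close> pin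
    \<open>P\<close> to \<open>k\<close>.\<close>
  have lower_eq: "k * (1 / r)\<^sup>2 = P \<longleftrightarrow> r = 1"
  proof
    assume "k * (1 / r)\<^sup>2 = P"
    then have "k * (1 / r)\<^sup>2 = k"
      using lower P_lower by linarith
    then have "k = 0 \<or> r\<^sup>2 = 1"
      using r_ge by (auto simp: field_simps)
    then show "r = 1"
      using k_zero r_ge by (auto simp: power2_eq_1_iff)
  next
    assume "r = 1"
    then show "k * (1 / r)\<^sup>2 = P"
      using P_lower P_upper by simp
  qed
  \<comment> \<open>Here the chain that collapses is
    \<open>P \<le> k * r \<le> k * r\<^sup>2\<close>.\<close>
  have upper_eq: "P = k * r\<^sup>2 \<longleftrightarrow> r = 1"
  proof
    assume "P = k * r\<^sup>2"
    then have "k * r\<^sup>2 = k * r"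
      using upper P_upper by linarith
    then have "k = 0 \<or> r = 1"
      using r_ge by (auto simp: power2_eq_square)
    then show "r = 1"
      using k_zero by auto
  next
    assume "r = 1"
    then show "P = k * r\<^sup>2"
      using P_lower P_upper by simp
  qed
  show ?thesis
    unfolding radicand regular DSO inv r_def[symmetric]
    using lower upper P_lower P_upper lower_eq upper_eq by simp
qed

end
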